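(* Let $\rho>0$, let $1\le k<n_2$, and let $a\in\mathbb{R}^{n_2}$ be a nonzero vector with $a_1\ge\dots\ge a_{n_2}\ge0$. Let $w=(a_1,\dots,a_k)^T$, $c=\sqrt{\sum_{i=k+1}^{n_2}a_i^2}$, $\ell=\|w\|_0$, and let $d_\rho(w,c)\in\mathbb{R}^k$ be an optimal solution to $$\min_{s\in\mathbb{R}^k,\ s\ge0}\ \sqrt{\|s-w\|_2^2+c^2}+\rho\langle s,1_k\rangle.$$ Then $[d_\rho(w,c);0_{n_2-k}]\in\mathbb{R}^{n_2}$ is an optimal solution to $$\min_{s\in\mathbb{R}^{n_2},\ s\ge0}\ \|s-a\|_2+\rho\langle 1_{n_2},s\rangle$$ if and only if $$\rho\ge\frac{a_{\ell+1}}{\sqrt{\ell a_{\ell+1}^2+c^2}}.$$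
   Context: $\|w\|_0$ is the number of nonzero entries of $w$; $1_m$ and $0_m$ are the all-ones and zero vectors in $\mathbb{R}^m$; $[x;y]$ is vertical concatenation; $s\ge0$ is entrywise. When $c=0$ (in which case $a_{\ell+1}=0$), the fraction $\frac{a_{\ell+1}}{\sqrt{\ell a_{\ell+1}^2+c^2}}$ is understood to be $0$. *)

theory Defs
  imports Complex_Main "Jordan_Normal_Form.Matrix"
begin

text \<open>
  A vector in \<open>\<real>\<^sup>n\<close> is an element of \<^term>\<open>carrier_vec n\<close>. Components are numbered from 0, so
  the component written \<open>a\<^sub>i\<close> in 1-based notation is \<open>a $ (i - 1)\<close>. The order on vectors
  is entrywise.
\<close>

definition norm2 :: "real vec \<Rightarrow> real" where
  "norm2 v = sqrt (v \<bullet> v)"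

definition norm0 :: "real vec \<Rightarrow> nat" where
  "norm0 v = card {i. i < dim_vec v \<and> v $ i \<noteq> 0}"

definition ones_vec :: "nat \<Rightarrow> real vec" where
  "ones_vec n = vec n (\<lambda>_. 1)"

definition nonneg_vecs :: "nat \<Rightarrow> real vec set" where
  "nonneg_vecs n = {s \<in> carrier_vec n. 0\<^sub>v n \<le> s}"

definition is_optimal_full :: "real \<Rightarrow> real vec \<Rightarrow> real vec \<Rightarrow> bool" where
  "is_optimal_full \<rho> a x \<longleftrightarrow>
     is_arg_min (\<lambda>s. norm2 (s - a) + \<rho> * (ones_vec (dim_vec a) \<bullet> s))
       (\<lambda>s. s \<in> nonneg_vecs (dim_vec a)) x"

definition is_optimal_reduced :: "real \<Rightarrow> real vec \<Rightarrow> real \<Rightarrow> real vec \<Rightarrow> bool" where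
  "is_optimal_reduced \<rho> w c x \<longleftrightarrow>
     is_arg_min (\<lambda>s. sqrt ((norm2 (s - w))\<^sup>2 + c\<^sup>2) + \<rho> * (s \<bullet> ones_vec (dim_vec w)))
       (\<lambda>s. s \<in> nonneg_vecs (dim_vec w)) x"

text \<open>\<open>t\<close> stands for \<open>a\<^bsub>l+1\<^esub>\<close>; the quotient is 0 by convention when \<open>c = 0\<close>.\<close>

definition threshold :: "nat \<Rightarrow> real \<Rightarrow> real \<Rightarrow> real" where
  "threshold l t c = (if c = 0 then 0 else t / sqrt (real l * t\<^sup>2 + c\<^sup>2))"

end

theory Submission
  imports Defs "HOL-Analysis.L2_Norm"
begin

text \<open>
  Both problems minimise \<open>sqrt (\<parallel>s - b\<parallel>\<^sup>2 + e\<^sup>2) + \<rho> * \<langle>1, s\<rangle>\<close> over \<open>s \<ge> 0\<close>: the full one has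
  \<open>b = a\<close> and \<open>e = 0\<close>, the reduced one \<open>b = w\<close> and \<open>e = c\<close>. The idea is that optimality in this
  family has a closed form. If the root \<open>R\<close> is positive at \<open>x\<close>, then \<open>x\<close> is optimal exactly when
  it is the soft thresholding \<open>x\<^sub>i = max (b\<^sub>i - \<rho> * R) 0\<close>, which is the Karush-Kuhn-Tucker system
  solved for \<open>x\<close>. Necessity
  (\<open>optimal_imp_soft_threshold\<close>) comes from bounding the concave square root by its tangent at
  \<open>R\<^sup>2\<close>, so that \<open>x\<close> also minimises a quadratic in each coordinate, and sufficiency
  (\<open>soft_threshold_imp_optimal\<close>) comes from the Cauchy-Schwarz inequality.

  Let \<open>c \<noteq> 0\<close>, with entries counted from 1. Then \<open>t = a\<^sub>k\<^sub>+\<^sub>1\<close> is positive, so \<open>w\<close> has no zero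
  entry and \<open>l = k\<close>. Padding \<open>d\<close> by zeros moves the tail of \<open>a\<close> from the offset \<open>c\<close> into the
  distance and leaves \<open>R\<close> unchanged. The first \<open>k\<close> conditions for the padded vector are therefore
  those that \<open>d\<close> already satisfies, and the others say \<open>a\<^sub>i \<le> \<rho> * R\<close> for \<open>i > k\<close>, which by
  monotonicity reduces to \<open>t \<le> \<rho> * R\<close>. To eliminate \<open>R\<close>, insert the soft thresholding formula
  for \<open>d\<close> into \<open>R\<close>: the number \<open>z = \<rho> * R\<close> solves
  \<open>z\<^sup>2 = \<rho>\<^sup>2 * ((\<Sum>i\<le>k. (min w\<^sub>i z)\<^sup>2) + c\<^sup>2)\<close>. Each minimum is at most \<open>z\<close>, and equals \<open>z\<close> if
  \<open>z \<le> t\<close>, so comparing \<open>z\<close> with \<open>t\<close> amounts to comparing \<open>\<rho>\<close> with the threshold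
  (\<open>threshold_le_iff_fixed_point_ge\<close>).

  Let \<open>c = 0\<close>. The root may then vanish at the optimum, but the tail of \<open>a\<close> is zero, and cutting
  a feasible vector off after \<open>k\<close> entries never increases the objective. Padding is thus always
  optimal, in agreement with the threshold \<open>0\<close>.
\<close>

section \<open>The two problems in coordinates\<close>

lemma norm2_diff_sq:
  assumes "s \<in> carrier_vec n" "b \<in> carrier_vec n"
  shows "(norm2 (s - b))\<^sup>2 = (\<Sum>i<n. (s $ i - b $ i)\<^sup>2)"
  using assms
  by (auto simp: norm2_def scalar_prod_def power2_eq_square sum_nonneg atLeast0LessThan)

lemma scalar_prod_ones:
  assumes "dim_vec s = n"
  shows "s \<bullet> ones_vec n = (\<Sum>i<n. s $ i)"
  by (simp add: scalar_prod_def ones_vec_def atLeast0LessThan)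

lemma nonneg_vecs_iff:
  "s \<in> nonneg_vecs n \<longleftrightarrow> s \<in> carrier_vec n \<and> (\<forall>i<n. 0 \<le> s $ i)"
  by (auto simp: nonneg_vecs_def less_eq_vec_def)

definition penalized_dist :: "real \<Rightarrow> real vec \<Rightarrow> real \<Rightarrow> real vec \<Rightarrow> real" where
  "penalized_dist \<rho> b e s =
     sqrt ((\<Sum>i<dim_vec b. (s $ i - b $ i)\<^sup>2) + e\<^sup>2) + \<rho> * (\<Sum>i<dim_vec b. s $ i)"

lemma is_optimal_reduced_iff:
  "is_optimal_reduced \<rho> b e x \<longleftrightarrow> x \<in> nonneg_vecs (dim_vec b) \<and>
     (\<forall>y \<in> nonneg_vecs (dim_vec b). penalized_dist \<rho> b e x \<le> penalized_dist \<rho> b e y)"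
proof -
  have *: "sqrt ((norm2 (s - b))\<^sup>2 + e\<^sup>2) + \<rho> * (s \<bullet> ones_vec (dim_vec b)) = penalized_dist \<rho> b e s"
    if "s \<in> nonneg_vecs (dim_vec b)" for s
    using that by (simp add: nonneg_vecs_iff penalized_dist_def norm2_diff_sq[of _ "dim_vec b"] scalar_prod_ones)
  show ?thesis
    unfolding is_optimal_reduced_def is_arg_min_linorder by (auto simp: *)
qed

lemma is_optimal_full_iff_reduced: "is_optimal_full \<rho> a x \<longleftrightarrow> is_optimal_reduced \<rho> a 0 x"
proof -
  have n2: "norm2 v \<ge> 0" for v
    by (auto simp: norm2_def scalar_prod_def intro!: sum_nonneg)
  have *: "norm2 (s - a) + \<rho> * (ones_vec (dim_vec a) \<bullet> s) =
      sqrt ((norm2 (s - a))\<^sup>2 + 0\<^sup>2) + \<rho> * (s \<bullet> ones_vec (dim_vec a))"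
    if "s \<in> nonneg_vecs (dim_vec a)" for s
    using that n2 comm_scalar_prod[of s "dim_vec a" "ones_vec (dim_vec a)"]
    by (simp add: nonneg_vecs_iff ones_vec_def)
  show ?thesis
    unfolding is_optimal_full_def is_optimal_reduced_def is_arg_min_linorder
    using * by auto
qed

section \<open>Optimality as soft thresholding\<close>

text \<open>
  On the half-line the quadratic has no minimiser other than the projection of its vertex, so a
  point that does as well as the projection coincides with it.
\<close>

lemma projection_minimizes_quadratic:
  fixes x m :: real
  assumes "x \<ge> 0" and min: "(x - m)\<^sup>2 \<le> (max m 0 - m)\<^sup>2"
  shows "x = max m 0"
proof (cases "m \<ge> 0")
  case True
  then show ?thesis using min by simp
next
  case False
  then have "\<bar>x - m\<bar> \<le> \<bar>m\<bar>" unfolding abs_le_square_iff using min by simp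
  then show ?thesis using False assms(1) by simp
qed

text \<open>
  The tangent bound replaces the square root in the objective by a quadratic that agrees with it at
  the optimum, hence one that the optimum must minimise as well.
\<close>

lemma sqrt_le_tangent:
  fixes q r :: real
  assumes "r > 0" "q \<ge> 0"
  shows "sqrt q \<le> r + (q - r\<^sup>2) / (2 * r)"
proof -
  have "2 * r * sqrt q \<le> r\<^sup>2 + (sqrt q)\<^sup>2"
    using sum_squares_bound[of r "sqrt q"] by simp
  with assms show ?thesis by (simp add: field_simps power2_eq_square)
qed

text \<open>
  The Cauchy-Schwarz inequality for \<open>u\<close> and \<open>v\<close> extended by the common last coordinate \<open>e\<close>: the
  offset in the objective is a coordinate in which all points agree.
\<close>

lemma sum_product_plus_square_le:
  fixes u v :: "nat \<Rightarrow> real"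
  shows "(\<Sum>i<n. u i * v i) + e\<^sup>2 \<le>
     sqrt ((\<Sum>i<n. (u i)\<^sup>2) + e\<^sup>2) * sqrt ((\<Sum>i<n. (v i)\<^sup>2) + e\<^sup>2)"
proof -
  let ?u = "\<lambda>i. if i < n then u i else e" and ?v = "\<lambda>i. if i < n then v i else e"
  have "(\<Sum>i<Suc n. ?u i * ?v i) \<le> (\<Sum>i<Suc n. \<bar>?u i\<bar> * \<bar>?v i\<bar>)"
    by (intro sum_mono) (metis abs_ge_self abs_mult)
  also have "\<dots> \<le> L2_set ?u {..<Suc n} * L2_set ?v {..<Suc n}"
    by (rule L2_set_mult_ineq)
  finally show ?thesis by (simp add: L2_set_def power2_eq_square)
qed

text \<open>
  With \<open>u = x - b\<close>, the vector \<open>u / R\<close> is the gradient at \<open>x\<close> of the root, and thresholding makes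
  \<open>u / R + \<rho>\<close> nonnegative and zero wherever \<open>x\<close> is positive. Convexity of the root, in the form of
  the Cauchy-Schwarz inequality, turns this into global optimality.
\<close>

lemma soft_threshold_imp_optimal:
  assumes R: "R = sqrt ((\<Sum>i<dim_vec b. (x $ i - b $ i)\<^sup>2) + e\<^sup>2)" and pos: "R > 0"
    and x: "x \<in> nonneg_vecs (dim_vec b)"
    and soft: "\<forall>i<dim_vec b. x $ i = max (b $ i - \<rho> * R) 0"
  shows "is_optimal_reduced \<rho> b e x"
  unfolding is_optimal_reduced_iff
proof (intro conjI ballI)
  let ?n = "dim_vec b"
  fix y assume y: "y \<in> nonneg_vecs ?n"
  define S where "S = sqrt ((\<Sum>i<?n. (y $ i - b $ i)\<^sup>2) + e\<^sup>2)"
  have R2: "R\<^sup>2 = (\<Sum>i<?n. (x $ i - b $ i)\<^sup>2) + e\<^sup>2"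
    by (simp add: R sum_nonneg)
  have "(x $ i - b $ i) * (y $ i - x $ i) \<ge> - (\<rho> * R) * (y $ i - x $ i)" if "i < ?n" for i
  proof (cases "b $ i - \<rho> * R \<ge> 0")
    case True
    then show ?thesis using soft that by simp
  next
    case False
    then have "x $ i = 0" using soft that by simp
    moreover have "b $ i * y $ i \<le> \<rho> * R * y $ i"
      using False y that by (intro mult_right_mono) (auto simp: nonneg_vecs_iff)
    ultimately show ?thesis by simp
  qed
  then have "(\<Sum>i<?n. - (\<rho> * R) * (y $ i - x $ i)) \<le> (\<Sum>i<?n. (x $ i - b $ i) * (y $ i - x $ i))"
    by (intro sum_mono) auto
  also have "\<dots> = (\<Sum>i<?n. (x $ i - b $ i) * (y $ i - b $ i) - (x $ i - b $ i)\<^sup>2)"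
    by (intro sum.cong) (auto simp: power2_eq_square algebra_simps)
  also have "\<dots> = (\<Sum>i<?n. (x $ i - b $ i) * (y $ i - b $ i)) + e\<^sup>2 - R\<^sup>2"
    by (simp add: R2 sum_subtractf)
  also have "\<dots> \<le> R * S - R\<^sup>2"
    using sum_product_plus_square_le[of "\<lambda>i. x $ i - b $ i" "\<lambda>i. y $ i - b $ i" ?n e]
    by (simp add: R S_def)
  finally have "R * (R + \<rho> * (\<Sum>i<?n. x $ i)) \<le> R * (S + \<rho> * (\<Sum>i<?n. y $ i))"
    unfolding sum_distrib_left[symmetric] sum_subtractf
    by (simp add: algebra_simps power2_eq_square)
  then show "penalized_dist \<rho> b e x \<le> penalized_dist \<rho> b e y"
    using pos by (simp add: penalized_dist_def R[symmetric] S_def[symmetric])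
qed (rule x)

text \<open>
  Replacing coordinate \<open>i\<close> of \<open>x\<close> by \<open>p \<ge> 0\<close> does not decrease the objective, so it does not
  decrease its tangent majorant. As a function of \<open>p\<close> the majorant is, up to a positive factor and a
  constant, \<open>(p - (b\<^sub>i - \<rho> * R))\<^sup>2\<close>, hence \<open>x\<^sub>i\<close> is the projection of \<open>b\<^sub>i - \<rho> * R\<close>.
\<close>

lemma optimal_imp_soft_threshold:
  assumes R: "R = sqrt ((\<Sum>i<dim_vec b. (x $ i - b $ i)\<^sup>2) + e\<^sup>2)" and pos: "R > 0"
    and opt: "is_optimal_reduced \<rho> b e x" and i: "i < dim_vec b"
  shows "x $ i = max (b $ i - \<rho> * R) 0"
proof (rule projection_minimizes_quadratic)
  let ?n = "dim_vec b"
  have x: "x \<in> carrier_vec ?n" "\<And>j. j < ?n \<Longrightarrow> 0 \<le> x $ j"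
    using opt by (auto simp: is_optimal_reduced_iff nonneg_vecs_iff)
  show "0 \<le> x $ i" using x(2) i .
  define m where "m = b $ i - \<rho> * R"
  define p where "p = max m 0"
  define y where "y = vec ?n (\<lambda>j. if j = i then p else x $ j)"
  have y: "y \<in> nonneg_vecs ?n"
    using x by (auto simp: nonneg_vecs_iff y_def p_def)
  have R2: "R\<^sup>2 = (\<Sum>j<?n. (x $ j - b $ j)\<^sup>2) + e\<^sup>2"
    by (simp add: R sum_nonneg)
  have sumx: "(\<Sum>j<?n. f j) = f i + (\<Sum>j\<in>{..<?n}-{i}. f j)" for f :: "nat \<Rightarrow> real"
    using i by (intro sum.remove) auto
  have Q: "(\<Sum>j<?n. (y $ j - b $ j)\<^sup>2) + e\<^sup>2 = R\<^sup>2 + (p - b $ i)\<^sup>2 - (x $ i - b $ i)\<^sup>2"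
    unfolding R2 using i by (simp add: sumx y_def)
  have Qnn: "0 \<le> R\<^sup>2 + (p - b $ i)\<^sup>2 - (x $ i - b $ i)\<^sup>2"
    unfolding Q[symmetric] by (simp add: sum_nonneg)
  have L: "(\<Sum>j<?n. y $ j) = (\<Sum>j<?n. x $ j) + p - x $ i"
    using i by (simp add: sumx y_def)
  have "R + \<rho> * (\<Sum>j<?n. x $ j) \<le> penalized_dist \<rho> b e y"
    using opt y by (auto simp: is_optimal_reduced_iff penalized_dist_def R)
  also have "\<dots> \<le> R + ((p - b $ i)\<^sup>2 - (x $ i - b $ i)\<^sup>2) / (2 * R) + \<rho> * ((\<Sum>j<?n. x $ j) + p - x $ i)"
    unfolding penalized_dist_def Q L
    using sqrt_le_tangent[OF pos, of "R\<^sup>2 + (p - b $ i)\<^sup>2 - (x $ i - b $ i)\<^sup>2"] Qnn by simp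
  finally have "0 \<le> ((p - b $ i)\<^sup>2 - (x $ i - b $ i)\<^sup>2) / (2 * R) + \<rho> * (p - x $ i)"
    by (simp add: algebra_simps)
  then have "0 \<le> (p - b $ i)\<^sup>2 - (x $ i - b $ i)\<^sup>2 + 2 * R * \<rho> * (p - x $ i)"
    using pos by (simp add: field_simps)
  also have "\<dots> = (p - m)\<^sup>2 - (x $ i - m)\<^sup>2"
    by (simp add: m_def power2_eq_square algebra_simps)
  finally show "(x $ i - (b $ i - \<rho> * R))\<^sup>2 \<le> (max (b $ i - \<rho> * R) 0 - (b $ i - \<rho> * R))\<^sup>2"
    by (simp add: p_def m_def)
qed

section \<open>Comparing the fixed point with the threshold\<close>

text \<open>
  The minima are at most \<open>x\<close>, so the fixed point equation divided by \<open>x\<^sup>2\<close> gives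
  \<open>1 \<le> \<rho>\<^sup>2 * (k + c\<^sup>2 / x\<^sup>2)\<close>, with equality for \<open>x \<le> t\<close>, where all minima are \<open>x\<close>. Since \<open>k + c\<^sup>2 / s\<^sup>2\<close> is strictly
  decreasing in \<open>s\<close>, passing from \<open>x\<close> to \<open>t\<close> decides whether \<open>1 \<le> \<rho>\<^sup>2 * (k + c\<^sup>2 / t\<^sup>2)\<close>, which is
  the threshold condition.
\<close>

lemma threshold_le_iff_fixed_point_ge:
  fixes x t c \<rho> :: real and w :: "nat \<Rightarrow> real"
  assumes "\<rho> > 0" "t > 0" "x > 0" and c: "c \<noteq> 0"
    and w: "\<And>i. i < k \<Longrightarrow> t \<le> w i"
    and fixpoint: "x\<^sup>2 = \<rho>\<^sup>2 * ((\<Sum>i<k. (min (w i) x)\<^sup>2) + c\<^sup>2)"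
  shows "t \<le> x \<longleftrightarrow> t / sqrt (real k * t\<^sup>2 + c\<^sup>2) \<le> \<rho>"
proof -
  let ?h = "\<lambda>s. real k + c\<^sup>2 / s\<^sup>2"
  have c2: "c\<^sup>2 > 0" using c by simp
  have S: "real k * t\<^sup>2 + c\<^sup>2 > 0"
    using c2 by (intro add_nonneg_pos) auto
  have "t / sqrt (real k * t\<^sup>2 + c\<^sup>2) \<le> \<rho> \<longleftrightarrow> t \<le> \<rho> * sqrt (real k * t\<^sup>2 + c\<^sup>2)"
    using S by (simp add: pos_divide_le_eq)
  also have "\<dots> \<longleftrightarrow> t\<^sup>2 \<le> (\<rho> * sqrt (real k * t\<^sup>2 + c\<^sup>2))\<^sup>2"
    using assms S by (subst abs_le_square_iff[symmetric]) simp
  also have "\<dots> \<longleftrightarrow> t\<^sup>2 \<le> \<rho>\<^sup>2 * (real k * t\<^sup>2 + c\<^sup>2)"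
    using S by (simp add: power_mult_distrib)
  also have "\<dots> \<longleftrightarrow> 1 \<le> \<rho>\<^sup>2 * ?h t"
    using \<open>t > 0\<close> by (simp add: field_simps)
  finally have thr: "t / sqrt (real k * t\<^sup>2 + c\<^sup>2) \<le> \<rho> \<longleftrightarrow> 1 \<le> \<rho>\<^sup>2 * ?h t" .
  show ?thesis
  proof (cases "t \<le> x")
    case True
    have "(min (w i) x)\<^sup>2 \<le> x\<^sup>2" if "i < k" for i
      using w[OF that] assms by (intro power_mono) auto
    then have "(\<Sum>i<k. (min (w i) x)\<^sup>2) \<le> real k * x\<^sup>2"
      using sum_bounded_above[of "{..<k}" "\<lambda>i. (min (w i) x)\<^sup>2" "x\<^sup>2"] by simp
    then have "x\<^sup>2 \<le> \<rho>\<^sup>2 * (real k * x\<^sup>2 + c\<^sup>2)"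
      unfolding fixpoint by (intro mult_left_mono) (auto simp: fixpoint[symmetric])
    then have "1 \<le> \<rho>\<^sup>2 * ?h x"
      using \<open>x > 0\<close> by (simp add: field_simps)
    also have "\<dots> \<le> \<rho>\<^sup>2 * ?h t"
      using True \<open>t > 0\<close> by (intro mult_left_mono add_left_mono divide_left_mono power_mono)
        auto
    finally show ?thesis using True thr by simp
  next
    case False
    have "(\<Sum>i<k. (min (w i) x)\<^sup>2) = (\<Sum>i<k. x\<^sup>2)"
      using w False by (intro sum.cong refl) (force simp: min_def)
    then have "x\<^sup>2 = \<rho>\<^sup>2 * (real k * x\<^sup>2 + c\<^sup>2)" using fixpoint by simp
    then have "1 = \<rho>\<^sup>2 * ?h x"
      using \<open>x > 0\<close> by (simp add: field_simps)
    also have "\<dots> > \<rho>\<^sup>2 * ?h t"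
      using False \<open>x > 0\<close> \<open>\<rho> > 0\<close> c2 by (intro mult_strict_left_mono add_strict_left_mono
          divide_strict_left_mono power_strict_mono) auto
    finally show ?thesis using False thr by simp
  qed
qed

section \<open>Padding by zeros\<close>

lemma sum_lessThan_split:
  fixes u :: "nat \<Rightarrow> real"
  assumes "k \<le> n"
  shows "(\<Sum>i<n. u i) = (\<Sum>i<k. u i) + (\<Sum>i=k..<n. u i)"
  using assms by (simp add: lessThan_atLeast0 sum.atLeastLessThan_concat)

text \<open>
  Padding moves the tail of \<open>a\<close> from the offset into the distance, which keeps the root and the
  whole objective.
\<close>

lemma sum_sq_append_zero:
  assumes "u \<in> carrier_vec k" "k \<le> n"
  shows "(\<Sum>i<n. ((u @\<^sub>v 0\<^sub>v (n - k)) $ i - a $ i)\<^sup>2) =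
     (\<Sum>i<k. (u $ i - a $ i)\<^sup>2) + (\<Sum>i=k..<n. (a $ i :: real)\<^sup>2)"
proof -
  have "(\<Sum>i=k..<n. (0\<^sub>v (n - k) $ (i - k) - a $ i)\<^sup>2) = (\<Sum>i=k..<n. (a $ i)\<^sup>2)"
    by (rule sum.cong) auto
  then show ?thesis
    using assms by (simp add: sum_lessThan_split[of k n])
qed

lemma penalized_dist_append:
  assumes "dim_vec a = n" "k \<le> n" "u \<in> carrier_vec k"
  shows "penalized_dist \<rho> a 0 (u @\<^sub>v 0\<^sub>v (n - k)) =
     penalized_dist \<rho> (vec_first a k) (sqrt (\<Sum>i=k..<n. (a $ i)\<^sup>2)) u"
proof -
  have "(\<Sum>i=k..<n. 0\<^sub>v (n - k) $ (i - k)) = (0 :: real)"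
    by (rule sum.neutral) auto
  then have "(\<Sum>i<n. (u @\<^sub>v 0\<^sub>v (n - k)) $ i) = (\<Sum>i<k. u $ i)"
    using assms by (simp add: sum_lessThan_split[of k n])
  then show ?thesis
    using assms sum_sq_append_zero[of u k n a]
    by (simp add: penalized_dist_def vec_first_def sum_nonneg del: index_append_vec)
qed

theorem proposition8:
  fixes \<rho> c :: real and k n\<^sub>2 l :: nat and a w d :: "real vec"
  assumes "\<rho> > 0"
    and "1 \<le> k" and "k < n\<^sub>2"
    and "a \<in> carrier_vec n\<^sub>2" and "a \<noteq> 0\<^sub>v n\<^sub>2"
    and "\<And>i j. i \<le> j \<Longrightarrow> j < n\<^sub>2 \<Longrightarrow> a $ j \<le> a $ i"
    and "0\<^sub>v n\<^sub>2 \<le> a"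
    and "w = vec_first a k"
    and "c = sqrt (\<Sum>i = k..<n\<^sub>2. (a $ i)\<^sup>2)"
    and "l = norm0 w"
    and "is_optimal_reduced \<rho> w c d"
  shows "is_optimal_full \<rho> a (d @\<^sub>v 0\<^sub>v (n\<^sub>2 - k)) \<longleftrightarrow> \<rho> \<ge> threshold l (a $ l) c"
proof -
  let ?x = "d @\<^sub>v 0\<^sub>v (n\<^sub>2 - k)"
  note sorted = assms(6)
  have dims: "dim_vec a = n\<^sub>2" "dim_vec w = k" "\<And>i. i < k \<Longrightarrow> w $ i = a $ i"
    using assms(4,8) by (auto simp: vec_first_def)
  have a_nonneg: "0 \<le> a $ i" if "i < n\<^sub>2" for i
    using assms(7) that by (auto simp: less_eq_vec_def)
  have d: "d \<in> carrier_vec k" "\<And>i. i < k \<Longrightarrow> 0 \<le> d $ i"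
    using assms(11) by (auto simp: is_optimal_reduced_iff nonneg_vecs_iff dims)
  have x: "?x \<in> nonneg_vecs n\<^sub>2"
    using d \<open>k < n\<^sub>2\<close> append_carrier_vec[OF d(1) zero_carrier_vec[of "n\<^sub>2 - k"]]
    by (auto simp: nonneg_vecs_iff)
  have c2: "c\<^sup>2 = (\<Sum>i = k..<n\<^sub>2. (a $ i)\<^sup>2)"
    by (simp add: assms(9) sum_nonneg)
  show ?thesis
  proof (cases "c = 0")
    case True
    have "is_optimal_full \<rho> a ?x"
      unfolding is_optimal_full_iff_reduced is_optimal_reduced_iff dims
    proof (intro conjI ballI x)
      fix y assume y: "y \<in> nonneg_vecs n\<^sub>2"
      have "penalized_dist \<rho> a 0 ?x = penalized_dist \<rho> w c d"
        using penalized_dist_append[OF dims(1) _ d(1)] assms(3,8,9) by simp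
      also have "\<dots> \<le> penalized_dist \<rho> w c (vec_first y k)"
        using assms(3,11) y
        by (auto simp: is_optimal_reduced_iff dims nonneg_vecs_iff vec_first_def)
      \<comment> \<open>the dropped entries contribute only nonnegative terms to the objective\<close>
      also have "\<dots> \<le> penalized_dist \<rho> a 0 y"
        unfolding penalized_dist_def dims sum_lessThan_split[OF less_imp_le[OF \<open>k < n\<^sub>2\<close>]]
        using y \<open>\<rho> > 0\<close> True
        by (auto simp: vec_first_def dims nonneg_vecs_iff
            intro!: add_mono mult_left_mono sum_nonneg)
      finally show "penalized_dist \<rho> a 0 ?x \<le> penalized_dist \<rho> a 0 y" .
    qed
    then show ?thesis using True \<open>\<rho> > 0\<close> by (simp add: threshold_def)
  next
    case False
    have t: "a $ k > 0"
    proof (rule ccontr)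
      assume "\<not> a $ k > 0"
      then have "a $ i = 0" if "k \<le> i" "i < n\<^sub>2" for i
        using sorted[OF that] a_nonneg[OF that(2)] by linarith
      then show False using False by (simp add: assms(9))
    qed
    have wt: "a $ k \<le> w $ i" if "i < k" for i
      using sorted[of i k] that dims \<open>k < n\<^sub>2\<close> by simp
    have "{i. i < dim_vec w \<and> w $ i \<noteq> 0} = {..<k}"
      using wt t by (force simp: dims)
    then have l: "l = k" by (simp add: assms(10) norm0_def)
    define R where "R = sqrt ((\<Sum>i<dim_vec w. (d $ i - w $ i)\<^sup>2) + c\<^sup>2)"
    have R_pos: "R > 0"
      unfolding R_def using False by (auto intro!: add_nonneg_pos sum_nonneg)
    have R_full: "R = sqrt ((\<Sum>i<dim_vec a. (?x $ i - a $ i)\<^sup>2) + 0\<^sup>2)"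
      unfolding R_def using sum_sq_append_zero[OF d(1) less_imp_le[OF \<open>k < n\<^sub>2\<close>], of a]
      by (simp add: dims c2 del: index_append_vec)
    have d_soft: "d $ i = max (w $ i - \<rho> * R) 0" if "i < k" for i
      using optimal_imp_soft_threshold[OF R_def R_pos assms(11)] that by (simp add: dims)
    have "is_optimal_full \<rho> a ?x \<longleftrightarrow> (\<forall>i<n\<^sub>2. ?x $ i = max (a $ i - \<rho> * R) 0)"
      unfolding is_optimal_full_iff_reduced
      using soft_threshold_imp_optimal[OF R_full R_pos, unfolded dims(1)]
        optimal_imp_soft_threshold[OF R_full R_pos, unfolded dims(1)] x
      by blast
    also have "\<dots> \<longleftrightarrow> (\<forall>i. k \<le> i \<and> i < n\<^sub>2 \<longrightarrow> a $ i \<le> \<rho> * R)"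
    proof -
      have "?x $ i = max (a $ i - \<rho> * R) 0 \<longleftrightarrow> (k \<le> i \<longrightarrow> a $ i \<le> \<rho> * R)" if "i < n\<^sub>2" for i
        using d d_soft[of i] that by (auto simp: dims)
      then show ?thesis by blast
    qed
    also have "\<dots> \<longleftrightarrow> a $ k \<le> \<rho> * R"
    proof
      assume "a $ k \<le> \<rho> * R"
      then show "\<forall>i. k \<le> i \<and> i < n\<^sub>2 \<longrightarrow> a $ i \<le> \<rho> * R"
        by (intro allI impI) (auto intro: order_trans[OF sorted[of k]])
    qed (use \<open>k < n\<^sub>2\<close> in simp)
    also have "\<dots> \<longleftrightarrow> a $ k / sqrt (real k * (a $ k)\<^sup>2 + c\<^sup>2) \<le> \<rho>"
    proof (rule threshold_le_iff_fixed_point_ge[OF \<open>\<rho> > 0\<close> t _ False wt])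
      show "0 < \<rho> * R" using \<open>\<rho> > 0\<close> R_pos by simp
      have "(d $ i - w $ i)\<^sup>2 = (min (w $ i) (\<rho> * R))\<^sup>2" if "i < k" for i
        using d_soft[OF that] by (auto simp: max_def min_def)
      then have "(\<Sum>i<k. (d $ i - w $ i)\<^sup>2) = (\<Sum>i<k. (min (w $ i) (\<rho> * R))\<^sup>2)"
        by (intro sum.cong) auto
      moreover have "R\<^sup>2 = (\<Sum>i<k. (d $ i - w $ i)\<^sup>2) + c\<^sup>2"
        by (simp add: R_def dims(2) sum_nonneg)
      ultimately show "(\<rho> * R)\<^sup>2 = \<rho>\<^sup>2 * ((\<Sum>i<k. (min (w $ i) (\<rho> * R))\<^sup>2) + c\<^sup>2)"
        by (simp add: power_mult_distrib)
    qed
    finally show ?thesis using False by (simp add: threshold_def l)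
  qed
qed
end
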